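(* For integers $n,i,j\ge 0$, let $\mathcal{C}^*(n;i,j)$ denote the number of partitions of $n$ into parts greater than $1$ such that consecutive parts differ by at least $2$, and by at least $5$ if neither the larger part nor the sum of the two parts is divisible by $3$, such that no three successive parts differ (successively) by $2$, and having $i$ parts congruent to $1$ modulo $3$ and $j$ parts congruent to $2$ modulo $3$. Let $\mathcal{D}(n;i,j)$ denote the number of partitions of $n$ into distinct parts not congruent to $\pm 1$ modulo $6$, having $i$ parts congruent to $1$ modulo $3$ and $j$ parts congruent to $2$ modulo $3$. Then $\mathcal{C}^*(n;i,j) = \mathcal{D}(n;i,j)$.
   Context: Partitions are non-increasing sequences $\lambda_1\ge\lambda_2\ge\dots$ of positive integers; "consecutive parts differ by at least $m$" means $\lambda_k-\lambda_{k+1}\ge m$ for all $k$, and "no three successive parts differ by $2$" means there is no $k$ with $\lambda_k-\lambda_{k+1}=\lambda_{k+1}-\lambda_{k+2}=2$. *)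

theory Defs
  imports Main
begin

definition is_partition :: "nat \<Rightarrow> nat list \<Rightarrow> bool" where
  "is_partition n ps \<longleftrightarrow>
     sorted_wrt (\<ge>) ps \<and> (\<forall>p \<in> set ps. p > 0) \<and> sum_list ps = n"

definition parts_congruent :: "nat \<Rightarrow> nat \<Rightarrow> nat list \<Rightarrow> nat" where
  "parts_congruent r m ps = length (filter (\<lambda>p. p mod m = r mod m) ps)"

(* The lists are only ever non-increasing, so the differences below are never truncated. *)

definition gap_condition :: "nat list \<Rightarrow> bool" where
  "gap_condition ps \<longleftrightarrow>
     (\<forall>k. Suc k < length ps \<longrightarrow>
        ps ! k - ps ! Suc k \<ge> 2 \<and>
        (\<not> 3 dvd ps ! k \<and> \<not> 3 dvd (ps ! k + ps ! Suc k) \<longrightarrow> ps ! k - ps ! Suc k \<ge> 5))"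

definition no_three_successive_by_2 :: "nat list \<Rightarrow> bool" where
  "no_three_successive_by_2 ps \<longleftrightarrow>
     \<not> (\<exists>k. k + 2 < length ps \<and>
            ps ! k - ps ! (k + 1) = 2 \<and> ps ! (k + 1) - ps ! (k + 2) = 2)"

definition C_star_partitions :: "nat \<Rightarrow> nat \<Rightarrow> nat \<Rightarrow> nat list set" where
  "C_star_partitions n i j =
     {ps. is_partition n ps \<and> (\<forall>p \<in> set ps. p > 1) \<and>
          gap_condition ps \<and> no_three_successive_by_2 ps \<and>
          parts_congruent 1 3 ps = i \<and> parts_congruent 2 3 ps = j}"

definition D_partitions :: "nat \<Rightarrow> nat \<Rightarrow> nat \<Rightarrow> nat list set" where
  "D_partitions n i j =
     {ps. is_partition n ps \<and> distinct ps \<and>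
          (\<forall>p \<in> set ps. p mod 6 \<noteq> 1 \<and> p mod 6 \<noteq> 5) \<and>
          parts_congruent 1 3 ps = i \<and> parts_congruent 2 3 ps = j}"

definition C_star :: "nat \<Rightarrow> nat \<Rightarrow> nat \<Rightarrow> nat" where
  "C_star n i j = card (C_star_partitions n i j)"

definition D :: "nat \<Rightarrow> nat \<Rightarrow> nat \<Rightarrow> nat" where
  "D n i j = card (D_partitions n i j)"

lemma finite_partitions: "finite {ps. is_partition n ps}"
proof (rule finite_subset)
  have "length ps \<le> sum_list ps" if "\<forall>p \<in> set ps. p > 0" for ps :: "nat list"
    using that by (induction ps) (auto simp: Suc_le_eq)
  then show "{ps. is_partition n ps} \<subseteq> {ps. set ps \<subseteq> {..n} \<and> length ps \<le> n}"
    by (auto simp: is_partition_def dest: member_le_sum_list)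
  show "finite {ps. set ps \<subseteq> {..n} \<and> length ps \<le> n}"
    by (rule finite_lists_length_le) simp
qed

lemma finite_C_star_partitions: "finite (C_star_partitions n i j)"
  by (rule finite_subset[OF _ finite_partitions[of n]]) (auto simp: C_star_partitions_def)

lemma finite_D_partitions: "finite (D_partitions n i j)"
  by (rule finite_subset[OF _ finite_partitions[of n]]) (auto simp: D_partitions_def)

end

theory Submission
  imports Defs "HOL-Computational_Algebra.Formal_Power_Series"
begin

text \<open>
  Read each partition from the smallest part upwards and let its word be the sequence of residues
  modulo 3 of the parts not divisible by 3. The word determines \<open>i\<close> and \<open>j\<close>, and the two kinds of
  partitions turn out to be equinumerous for every single word \<open>w\<close>. Put \<open>s = length w\<close> and
  \<open>Q = q\<^sup>3\<close>. If the smallest part is restricted to be (roughly) at least \<open>3l\<close>, the generating function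
  is \<open>q^(base w) Q^(s l) (1 + Q^(l+s)) (1 + Q^(l+s+1)) \<dots> / (Q; Q)\<^sub>s\<close> on the \<open>C\<^sup>*\<close> side, while on the
  \<open>D\<close> side, with smallest part greater than \<open>6l\<close>, it is
  \<open>q^(base w) Q^(2 s l) (1 + Q^(2l+1)) (1 + Q^(2l+2)) \<dots> / (Q\<^sup>2; Q\<^sup>2)\<^sub>s\<close>. Both formulas follow by
  induction on \<open>w\<close>: removing the smallest part gives a recurrence from \<open>l\<close> to \<open>l + 1\<close> that has only one
  solution tending to 0 in the \<open>q\<close>-adic topology. The totals agree because
  \<open>(Q\<^sup>2; Q\<^sup>2)\<^sub>s = (Q; Q)\<^sub>s (1 + Q) \<dots> (1 + Q^s)\<close>.
\<close>

unbundle fps_syntax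

subsection \<open>Generating functions of sets of lists\<close>

text \<open>Integer coefficients allow subtraction (\<open>gf_Diff\<close>) and, in an integral
  domain, cancellation of nonzero factors. As \<open>card\<close> is 0 on infinite sets, additivity
  is only claimed for lists without 0, where each sum is attained finitely often.\<close>

definition gf :: "nat list set \<Rightarrow> int fps" where
  "gf A = Abs_fps (\<lambda>n. int (card {xs \<in> A. sum_list xs = n}))"

lemma finite_lists_sum:
  assumes "\<forall>xs\<in>A. 0 \<notin> set xs"
  shows "finite {xs \<in> A. sum_list xs = (n::nat)}"
proof (rule finite_subset)
  have "length ps \<le> sum_list ps" if "0 \<notin> set ps" for ps :: "nat list"
    using that by (induction ps) (auto simp: Suc_le_eq)
  then show "{xs \<in> A. sum_list xs = n} \<subseteq> {ps. set ps \<subseteq> {..n} \<and> length ps \<le> n}"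
    using assms by (auto dest: member_le_sum_list)
  show "finite {ps. set ps \<subseteq> {..n} \<and> length ps \<le> n}"
    by (rule finite_lists_length_le) simp
qed

lemma gf_nth: "gf A $ n = int (card {xs \<in> A. sum_list xs = n})"
  by (simp add: gf_def)

lemma gf_empty [simp]: "gf {} = 0"
  by (simp add: fps_eq_iff gf_nth)

lemma gf_Un:
  assumes "\<forall>xs\<in>A. 0 \<notin> set xs" "\<forall>xs\<in>B. 0 \<notin> set xs" "A \<inter> B = {}"
  shows "gf (A \<union> B) = gf A + gf B"
proof (rule fps_ext)
  fix n
  have "{xs \<in> A \<union> B. sum_list xs = n} = {xs \<in> A. sum_list xs = n} \<union> {xs \<in> B. sum_list xs = n}"
    by auto
  moreover have "card \<dots> = card {xs \<in> A. sum_list xs = n} + card {xs \<in> B. sum_list xs = n}"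
    using assms by (intro card_Un_disjoint finite_lists_sum) auto
  ultimately show "gf (A \<union> B) $ n = (gf A + gf B) $ n"
    by (simp add: gf_nth)
qed

lemma gf_Diff:
  assumes "\<forall>xs\<in>A. 0 \<notin> set xs" "B \<subseteq> A"
  shows "gf (A - B) = gf A - gf B"
proof -
  have "gf ((A - B) \<union> B) = gf (A - B) + gf B"
    using assms by (intro gf_Un) auto
  moreover have "(A - B) \<union> B = A" using assms(2) by auto
  ultimately show ?thesis by simp
qed

lemma gf_Cons: "gf (Cons x ` A) = fps_X ^ x * gf A"
proof (rule fps_ext)
  fix n
  have "{xs \<in> Cons x ` A. sum_list xs = n} =
      (if n < x then {} else Cons x ` {xs \<in> A. sum_list xs = n - x})"
    by auto
  then show "gf (Cons x ` A) $ n = (fps_X ^ x * gf A) $ n"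
    by (simp add: gf_nth fps_X_power_mult_nth card_image)
qed

text \<open>Iterating the recurrence makes \<open>f l\<close> a multiple of
  \<open>f (l + Suc n)\<close>, which has no terms up to degree \<open>n\<close>. This gives
  uniqueness of solutions without any limit: it is applied to the difference of two
  solutions.\<close>

lemma fps_eq_0_of_telescoping:
  fixes f :: "nat \<Rightarrow> int fps"
  assumes step: "\<And>l. f l = g l * f (Suc l)"
    and small: "\<And>l n. n < l \<Longrightarrow> f l $ n = 0"
  shows "f l = 0"
proof -
  have ex: "\<exists>h. f l = h * f (l + k)" for k
  proof (induction k)
    case 0
    show ?case by (rule exI[of _ 1]) simp
  next
    case (Suc k)
    then obtain h where "f l = h * f (l + k)" by blast
    then have "f l = (h * g (l + k)) * f (l + Suc k)"
      using step[of "l + k"] by (simp add: mult.assoc)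
    then show ?case by blast
  qed
  show ?thesis
  proof (rule fps_ext)
    fix n
    obtain h where "f l = h * f (l + Suc n)" using ex by blast
    then show "f l $ n = 0 $ n"
      by (simp add: fps_mult_nth small)
  qed
qed

subsection \<open>Partitions with difference conditions\<close>

definition word :: "nat list \<Rightarrow> nat list" where
  "word xs = filter (\<lambda>r. r \<noteq> 0) (map (\<lambda>p. p mod 3) xs)"

lemma word_Nil [simp]: "word [] = []"
  by (simp add: word_def)

lemma word_Cons: "word (x # xs) = (if x mod 3 = 0 then word xs else (x mod 3) # word xs)"
  by (simp add: word_def)

text \<open>The smaller part comes first, as lists are read upwards; the divisibility test still
  concerns the larger part \<open>y\<close>. Additions avoid truncated subtraction.\<close>

definition step :: "nat \<Rightarrow> nat \<Rightarrow> bool" where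
  "step x y \<longleftrightarrow> x + 2 \<le> y \<and> (\<not> 3 dvd y \<and> \<not> 3 dvd (y + x) \<longrightarrow> x + 5 \<le> y)"

fun good :: "nat list \<Rightarrow> bool" where
  "good (x # y # zs) \<longleftrightarrow>
     step x y \<and> \<not> (zs \<noteq> [] \<and> y = x + 2 \<and> hd zs = y + 2) \<and> good (y # zs)"
| "good _ \<longleftrightarrow> True"

text \<open>
  Excluding \<open>3 * l + 1\<close> makes \<open>U (Suc l)\<close> exactly the set of tails that may follow a part \<open>3 * l\<close>,
  and \<open>U (l + 2)\<close> the set of tails that may follow \<open>3 * l + 4\<close>.
\<close>

definition U :: "nat \<Rightarrow> nat list \<Rightarrow> nat list set" where
  "U l w = {xs. good xs \<and> (\<forall>p\<in>set xs. 1 < p) \<and> word xs = w \<and>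
     (xs \<noteq> [] \<longrightarrow> 3 * l \<le> hd xs \<and> hd xs \<noteq> 3 * l + 1)}"

text \<open>Passing from \<open>U l w\<close> to \<open>U (Suc l) w\<close> loses the heads
  \<open>3 * l\<close>, \<open>3 * l + 2\<close> and \<open>3 * l + 4\<close>; \<open>Z\<close>
  collects the two that contribute a letter to the word.\<close>

definition Z :: "nat \<Rightarrow> nat list \<Rightarrow> nat list set" where
  "Z l w = {xs \<in> U l w. xs \<noteq> [] \<and> (hd xs = 3 * l + 2 \<or> hd xs = 3 * l + 4)}"

lemma U_pos: "\<forall>xs\<in>U l w. 0 \<notin> set xs"
  by (auto simp: U_def)

lemma good_ge: "good (x # xs) \<Longrightarrow> p \<in> set xs \<Longrightarrow> x < p"
proof (induction xs arbitrary: x)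
  case (Cons a xs)
  then have "x < a" "p = a \<or> a < p" by (auto simp: step_def)
  then show ?case by auto
qed simp

section \<open>Admissible successors of the smallest part, by its residue modulo 3\<close>

lemma good_Cons_eq:
  "good (x # xs) \<longleftrightarrow> good xs \<and> (xs \<noteq> [] \<longrightarrow> step x (hd xs) \<and>
     \<not> (tl xs \<noteq> [] \<and> hd xs = x + 2 \<and> hd (tl xs) = x + 4))"
  by (cases xs) auto

lemma step_residue_0: "step (3 * l) y \<longleftrightarrow> 3 * Suc l \<le> y \<and> y \<noteq> 3 * Suc l + 1"
  unfolding step_def by presburger

lemma step_residue_1: "step (3 * l + 4) y \<longleftrightarrow> 3 * (l + 2) \<le> y \<and> y \<noteq> 3 * (l + 2) + 1"
  unfolding step_def by presburger

text \<open>A successor of residue 1 makes the sum divisible by 3, so a gap of 2 suffices. This adds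
  \<open>3 * l + 4\<close> and \<open>3 * l + 7\<close> to the usual successors and is why the
  pattern 2, 1 in a word needs separate treatment.\<close>

lemma step_residue_2: "step (3 * l + 2) y \<longleftrightarrow>
    (3 * (l + 2) \<le> y \<and> y \<noteq> 3 * (l + 2) + 1) \<or> y = 3 * l + 4 \<or> y = 3 * l + 7"
  unfolding step_def by presburger

lemma Cons_mem_U_iff:
  "x # xs \<in> U l w \<longleftrightarrow> good (x # xs) \<and> 1 < x \<and> word (x # xs) = w \<and> 3 * l \<le> x \<and> x \<noteq> 3 * l + 1"
  unfolding U_def using good_ge[of x xs] by (auto dest: less_trans)

text \<open>\<open>U 0\<close> serves as the set without head restriction: at \<open>l = 0\<close>
  only the head 1 is excluded, and all parts exceed 1.\<close>

lemma Cons_mem_U_iff_tl: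
  "x # xs \<in> U l w \<longleftrightarrow> xs \<in> U 0 (word xs) \<and> (xs \<noteq> [] \<longrightarrow> step x (hd xs) \<and>
     \<not> (tl xs \<noteq> [] \<and> hd xs = x + 2 \<and> hd (tl xs) = x + 4))
    \<and> 1 < x \<and> word (x # xs) = w \<and> 3 * l \<le> x \<and> x \<noteq> 3 * l + 1"
proof -
  have "xs \<noteq> [] \<longrightarrow> 1 < hd xs" if "1 < x" "xs \<noteq> [] \<longrightarrow> step x (hd xs)"
    using that by (auto simp: step_def)
  then show ?thesis
    unfolding Cons_mem_U_iff good_Cons_eq by (cases xs) (auto simp: Cons_mem_U_iff, simp_all add: U_def)
qed

lemma mem_U_iff:
  "xs \<in> U l w \<longleftrightarrow> xs \<in> U 0 (word xs) \<and> word xs = w \<and>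
     (xs \<noteq> [] \<longrightarrow> 3 * l \<le> hd xs \<and> hd xs \<noteq> 3 * l + 1)"
  by (cases xs) (auto simp: Cons_mem_U_iff, simp_all add: U_def)

lemma Cons_mem_U_residue_0:
  assumes "0 < l"
  shows "3 * l # xs \<in> U l w \<longleftrightarrow> xs \<in> U (Suc l) w"
proof -
  have "\<not> (hd xs = 3 * l + 2)" if "step (3 * l) (hd xs)"
    using that unfolding step_residue_0 by auto
  then show ?thesis
    unfolding Cons_mem_U_iff_tl mem_U_iff[of xs "Suc l"] step_residue_0
    using assms by (auto simp: word_Cons)
qed

lemma Cons_mem_U_residue_1:
  "(3 * l + 4) # xs \<in> U l (1 # w) \<longleftrightarrow> xs \<in> U (l + 2) w"
proof -
  have "(3 * l + 4) mod 3 = 1" by presburger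
  \<comment> \<open>A difference of 2 cannot start at the multiple of 3 \<open>3 * l + 6\<close>:
    its successor is at least 3 larger.\<close>
  moreover have "\<not> (hd xs = 3 * l + 4 + 2 \<and> hd (tl xs) = 3 * l + 4 + 4)"
    if tl: "tl xs \<noteq> []" "xs \<in> U 0 (word xs)"
  proof -
    obtain y z zs where xs: "xs = y # z # zs" using tl(1) by (cases xs rule: good.cases) auto
    have "step y z" using tl(2) xs by (simp add: U_def)
    then show ?thesis using step_residue_0[of "l + 2" z] xs by (auto simp: add.commute)
  qed
  ultimately show ?thesis
    unfolding Cons_mem_U_iff_tl mem_U_iff[of xs "l + 2"] step_residue_1
    by (auto simp: word_Cons)
qed

text \<open>Here alone the ban on two successive differences of 2 takes effect: the only triple it
  removes has the shape \<open>3 * l + 2\<close>, \<open>3 * l + 4\<close>,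
  \<open>3 * l + 6\<close>.\<close>

lemma Cons_mem_U_residue_2:
  "(3 * l + 2) # xs \<in> U l (2 # w) \<longleftrightarrow> xs \<in> U (l + 2) w \<or>
     (xs \<in> U 0 w \<and> xs \<noteq> [] \<and> (hd xs = 3 * l + 7 \<or> (hd xs = 3 * l + 4 \<and> \<not> (tl xs \<noteq> [] \<and> hd (tl xs) = 3 * l + 6))))"
proof -
  have "(3 * l + 2) mod 3 = 2" by presburger
  then show ?thesis
    unfolding Cons_mem_U_iff_tl mem_U_iff[of xs "l + 2"] step_residue_2
    using mem_U_iff[of xs 0 w]
    by (auto simp: word_Cons)
qed

section \<open>Recurrences obtained by removing the smallest part\<close>

lemma U_Suc:
  assumes "0 < l"
  shows "U l w = U (Suc l) w \<union> (Cons (3 * l) ` U (Suc l) w \<union> Z l w)"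
proof (rule set_eqI)
  fix xs
  show "xs \<in> U l w \<longleftrightarrow> xs \<in> U (Suc l) w \<union> (Cons (3 * l) ` U (Suc l) w \<union> Z l w)"
  proof (cases xs)
    case (Cons x ys)
    show ?thesis
    proof (cases "x = 3 * l")
      case True
      then show ?thesis using Cons Cons_mem_U_residue_0[OF assms, of ys w]
        by (auto simp: Z_def Cons_mem_U_iff)
    next
      case False
      have "(3 * l \<le> x \<and> x \<noteq> 3 * l + 1) \<longleftrightarrow> (3 * Suc l \<le> x \<and> x \<noteq> 3 * Suc l + 1) \<or> x = 3 * l + 2 \<or> x = 3 * l + 4"
        using False by presburger
      then show ?thesis using False Cons
        unfolding Un_iff Z_def image_iff by (auto simp: Cons_mem_U_iff)
    qed
  qed (auto simp: U_def Z_def)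
qed

lemma U_0: "U 0 w = U 1 w \<union> Z 0 w"
proof (rule set_eqI)
  fix xs
  show "xs \<in> U 0 w \<longleftrightarrow> xs \<in> U 1 w \<union> Z 0 w"
    by (cases xs) (auto simp: Z_def U_def)
qed

lemma gf_U_Suc:
  assumes "0 < l"
  shows "gf (U l w) = (1 + fps_X ^ (3 * l)) * gf (U (Suc l) w) + gf (Z l w)"
proof -
  have "gf (U l w) = gf (U (Suc l) w) + (gf (Cons (3 * l) ` U (Suc l) w) + gf (Z l w))"
    unfolding U_Suc[OF assms]
    using assms by (subst gf_Un gf_Un; (force simp: U_def Z_def)?)+
  then show ?thesis by (simp add: gf_Cons algebra_simps)
qed

lemma gf_U_0: "gf (U 0 w) = gf (U 1 w) + gf (Z 0 w)"
  unfolding U_0 by (subst gf_Un) (auto simp: U_def Z_def)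

lemma Z_Nil: "Z l [] = {}"
proof -
  have "(3 * l + 2) mod 3 = 2" "(3 * l + 4) mod 3 = 1" by presburger+
  then have "(3 * l + 2) # ys \<notin> U l []" "(3 * l + 4) # ys \<notin> U l []" for ys
    by (simp_all add: Cons_mem_U_iff word_Cons)
  then show ?thesis
    unfolding Z_def by (auto simp: neq_Nil_conv)
qed

lemma Z_1: "Z l (1 # w) = Cons (3 * l + 4) ` U (l + 2) w"
proof -
  have "(3 * l + 2) mod 3 = 2" by presburger
  then have "(3 * l + 2) # ys \<notin> U l (1 # w)" for ys
    by (simp add: Cons_mem_U_iff word_Cons)
  then have "Z l (1 # w) = Cons (3 * l + 4) ` {ys. (3 * l + 4) # ys \<in> U l (1 # w)}"
    unfolding Z_def by (auto simp: neq_Nil_conv)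
  then show ?thesis by (simp only: Cons_mem_U_residue_1) simp
qed

lemma Z_2_aux: "Z l (2 # w) = Cons (3 * l + 2) ` {ys. (3 * l + 2) # ys \<in> U l (2 # w)}"
proof -
  have "(3 * l + 4) mod 3 = 1" by presburger
  then have "(3 * l + 4) # ys \<notin> U l (2 # w)" for ys
    by (simp add: Cons_mem_U_iff word_Cons)
  then show ?thesis
    unfolding Z_def by (auto simp: neq_Nil_conv)
qed

text \<open>The additional successors \<open>3 * l + 4\<close> and \<open>3 * l + 7\<close> have
  residue 1, so they would put the letter 1 at the front of \<open>w\<close>.\<close>

lemma Z_2:
  assumes "w = [] \<or> hd w \<noteq> 1"
  shows "Z l (2 # w) = Cons (3 * l + 2) ` U (l + 2) w"
proof -
  have "(3 * l + 4) mod 3 = 1" "(3 * l + 7) mod 3 = 1" by presburger+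
  then have "xs \<notin> U 0 w" if "xs \<noteq> []" "hd xs = 3 * l + 4 \<or> hd xs = 3 * l + 7" for xs
    using that assms by (auto simp: neq_Nil_conv U_def word_Cons)
  then show ?thesis unfolding Z_2_aux Cons_mem_U_residue_2 by blast
qed

text \<open>The second part is an ordinary successor, \<open>3 * l + 7\<close> or
  \<open>3 * l + 4\<close>; in the last case the set difference removes the forbidden triple ending
  in \<open>3 * l + 6\<close>.\<close>

lemma Z_2_1:
  "Z l (2 # 1 # w) = Cons (3 * l + 2) ` (U (l + 2) (1 # w) \<union> (Cons (3 * l + 7) ` U (l + 3) w
     \<union> Cons (3 * l + 4) ` (U (l + 2) w - Cons (3 * l + 6) ` U (l + 3) w)))"
proof -
  have eq: "3 * Suc l + 4 = 3 * l + 7" "Suc l + 2 = l + 3" "3 * (l + 2) = 3 * l + 6" "Suc (l + 2) = l + 3"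
    by simp_all
  have 7: "(3 * l + 7) # xs \<in> U 0 (1 # w) \<longleftrightarrow> xs \<in> U (l + 3) w" for xs
    using Cons_mem_U_residue_1[of "Suc l" xs w] unfolding eq by (simp add: Cons_mem_U_iff)
  have 4: "(3 * l + 4) # xs \<in> U 0 (1 # w) \<longleftrightarrow> xs \<in> U (l + 2) w" for xs
    using Cons_mem_U_residue_1[of l xs w] by (simp add: Cons_mem_U_iff)
  have 6: "(3 * l + 6) # xs \<in> U (l + 2) w \<longleftrightarrow> xs \<in> U (l + 3) w" for xs
    using Cons_mem_U_residue_0[of "l + 2" xs w] unfolding eq by simp
  have "{ys. (3 * l + 2) # ys \<in> U l (2 # 1 # w)} =
     U (l + 2) (1 # w) \<union> ({xs. xs \<in> U 0 (1 # w) \<and> xs \<noteq> [] \<and> hd xs = 3 * l + 7}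
     \<union> {xs. xs \<in> U 0 (1 # w) \<and> xs \<noteq> [] \<and> hd xs = 3 * l + 4 \<and> \<not> (tl xs \<noteq> [] \<and> hd (tl xs) = 3 * l + 6)})"
    unfolding Cons_mem_U_residue_2 by blast
  also have "{xs. xs \<in> U 0 (1 # w) \<and> xs \<noteq> [] \<and> hd xs = 3 * l + 7} = Cons (3 * l + 7) ` U (l + 3) w"
    by (auto simp: neq_Nil_conv 7 simp del: One_nat_def)
  also have "{xs. xs \<in> U 0 (1 # w) \<and> xs \<noteq> [] \<and> hd xs = 3 * l + 4 \<and> \<not> (tl xs \<noteq> [] \<and> hd (tl xs) = 3 * l + 6)}
     = Cons (3 * l + 4) ` (U (l + 2) w - Cons (3 * l + 6) ` U (l + 3) w)"
  proof (rule set_eqI)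
    fix xs
    show "xs \<in> {xs. xs \<in> U 0 (1 # w) \<and> xs \<noteq> [] \<and> hd xs = 3 * l + 4 \<and> \<not> (tl xs \<noteq> [] \<and> hd (tl xs) = 3 * l + 6)}
     \<longleftrightarrow> xs \<in> Cons (3 * l + 4) ` (U (l + 2) w - Cons (3 * l + 6) ` U (l + 3) w)"
      by (cases xs; cases "tl xs") (auto simp: 4 6 simp del: One_nat_def add_2_eq_Suc')
  qed
  finally show ?thesis unfolding Z_2_aux by simp
qed

lemma gf_Z_2_1:
  "gf (Z l (2 # 1 # w)) = fps_X ^ (3 * l + 2) * (gf (U (l + 2) (1 # w)) + fps_X ^ (3 * l + 7) * gf (U (l + 3) w)
     + fps_X ^ (3 * l + 4) * (gf (U (l + 2) w) - fps_X ^ (3 * l + 6) * gf (U (l + 3) w)))"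
proof -
  have eq: "3 * (l + 2) = 3 * l + 6" "Suc (l + 2) = l + 3"
    by simp_all
  have sub: "Cons (3 * l + 6) ` U (l + 3) w \<subseteq> U (l + 2) w"
    using Cons_mem_U_residue_0[of "l + 2" _ w] unfolding eq by auto
  show ?thesis
    unfolding Z_2_1 gf_Cons
    apply (subst gf_Un)
       apply (auto simp: U_def)[3]
    apply (subst gf_Un)
       apply (auto simp: U_def)[3]
    apply (simp only: gf_Cons gf_Diff[OF U_pos sub] add.assoc)
    done
qed

subsection \<open>The product formula for difference conditions\<close>

text \<open>The q-Pochhammer symbol \<open>(q^d; q^d)_s\<close>. Formulas are stated multiplied by
  it, so no power series is ever inverted.\<close>

definition qpoch :: "nat \<Rightarrow> nat \<Rightarrow> int fps" where
  "qpoch d s = (\<Prod>m=1..s. 1 - fps_X ^ (d * m))"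

lemma qpoch_0 [simp]: "qpoch d 0 = 1"
  by (simp add: qpoch_def)

lemma qpoch_Suc: "qpoch d (Suc s) = qpoch d s * (1 - fps_X ^ (d * Suc s))"
  by (simp add: qpoch_def prod.nat_ivl_Suc' mult.commute)

lemma fps_X_power_neq_1: "0 < k \<Longrightarrow> (fps_X ^ k :: int fps) \<noteq> 1"
proof
  assume "0 < k" "(fps_X ^ k :: int fps) = 1"
  then have "(fps_X ^ k :: int fps) $ 0 = 1 $ 0" by simp
  then show False using \<open>0 < k\<close> by simp
qed

lemma qpoch_neq_0: "0 < d \<Longrightarrow> qpoch d s \<noteq> 0"
  unfolding qpoch_def by (simp add: fps_X_power_neq_1)

text \<open>
  \<open>base w\<close> is the smallest possible sum of the parts not divisible by 3. The lowest part is 4 or 2, and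
  it pushes every part above it up by 6, unless its residue is 2 and the next one is 1.
\<close>

fun base :: "nat list \<Rightarrow> nat" where
  "base [] = 0"
| "base (x # w) = (if x = 1 then 4 else 2) + base w +
     (if x = 2 \<and> w \<noteq> [] \<and> hd w = 1 then 0 else 6 * length w)"

text \<open>For \<open>0 < l\<close> this is the product \<open>(1 + Q^l) (1 + Q^(l+1)) ...\<close>
  with \<open>Q = q^3\<close>, counting sets of multiples of 3 from \<open>3 * l\<close> on. Only
  its recurrence is used, never an infinite product.\<close>

abbreviation P :: "nat \<Rightarrow> int fps" where
  "P l \<equiv> gf (U l [])"

lemma P_Suc: "0 < l \<Longrightarrow> P l = (1 + fps_X ^ (3 * l)) * P (Suc l)"
  using gf_U_Suc[of l "[]"] by (simp add: Z_Nil)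

text \<open>The tails of lists in \<open>Z\<close> have shorter words and indices
  \<open>l + 2\<close> or \<open>l + 3\<close>, so the closed form for shorter words suffices.
  Taking that form as a hypothesis lets the lemma serve inside the induction and again at
  \<open>l = 0\<close>.\<close>

lemma gf_Z_closed:
  assumes IH: "\<And>v l. length v < length w \<Longrightarrow> set v \<subseteq> {1, 2} \<Longrightarrow> 0 < l \<Longrightarrow>
      qpoch 3 (length v) * gf (U l v) = fps_X ^ (base v + 3 * length v * l) * P (l + length v)"
    and w: "set w \<subseteq> {1, 2}"
  shows "qpoch 3 (length w) * gf (Z l w) =
    (1 - fps_X ^ (3 * length w)) * fps_X ^ (base w + 3 * length w * l) * P (Suc (l + length w))"
proof (cases w)
  case Nil
  then show ?thesis by (simp add: Z_Nil)
next
  case (Cons x v)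
  define t where "t = length v"
  have v: "set v \<subseteq> {1, 2}" and lv: "length v < length w" using w Cons by auto
  have x: "x = 1 \<or> x = 2" using w Cons by auto
  have sP: "P (l + 2 + t) = P (Suc (l + Suc t))" by simp
  show ?thesis
  proof (cases "x = 2 \<and> v \<noteq> [] \<and> hd v = 1")
    case False
    define c :: nat where "c = (if x = 1 then 4 else 2)"
    have b: "base w = c + base v + 6 * t"
      using False Cons by (auto simp: c_def t_def)
    have "gf (Z l w) = fps_X ^ (3 * l + c) * gf (U (l + 2) v)"
      using x False Cons Z_1[of l v] Z_2[of v l] by (auto simp: gf_Cons c_def)
    then have "qpoch 3 (length w) * gf (Z l w) =
        (1 - fps_X ^ (3 * Suc t)) * fps_X ^ (3 * l + c) * (qpoch 3 t * gf (U (l + 2) v))"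
      using Cons by (simp add: qpoch_Suc t_def mult_ac)
    also have "\<dots> = (1 - fps_X ^ (3 * Suc t)) * (fps_X ^ (3 * l + c) * fps_X ^ (base v + 3 * t * (l + 2))) * P (l + 2 + t)"
      using IH[OF lv v, of "l + 2"] by (simp add: t_def mult_ac)
    \<comment> \<open>The tail has index \<open>l + 2\<close>, which costs 6 for each of its
      \<open>t\<close> letters: the term \<open>6 * t\<close> in \<open>base w\<close>.\<close>
    also have "fps_X ^ (3 * l + c) * fps_X ^ (base v + 3 * t * (l + 2)) = (fps_X ^ (base w + 3 * Suc t * l) :: int fps)"
      unfolding b power_add[symmetric] by (rule arg_cong[where f = "(^) fps_X"]) (simp add: algebra_simps)
    finally show ?thesis unfolding sP using Cons by (simp add: t_def)
  next
    case True
    then obtain u where u: "w = 2 # 1 # u" using Cons by (cases v) auto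
    define t where "t = length u"
    have us: "set u \<subseteq> {1, 2}" "set (1 # u) \<subseteq> {1, 2::nat}" using w u by auto
    \<comment> \<open>\<open>A\<close> is the monomial of the tails through
      \<open>3 * l + 4\<close>, \<open>1 - y\<close> is the last factor of
      \<open>qpoch 3 (Suc t)\<close>, and \<open>1 + z\<close> is the factor by which
      \<open>P (l + 2 + t)\<close> exceeds \<open>P (l + 3 + t)\<close>.\<close>
    define A y z :: "int fps"
      where "A = fps_X ^ (4 + base u + 3 * l + 6 * t + 3 * t * l)"
        and "y = fps_X ^ (3 * t + 3)" and "z = fps_X ^ (3 * (l + 2 + t))"
    have b: "base w = 6 + base u + 6 * t" "base (1 # u) = 4 + base u + 6 * t"
      using u by (simp_all add: t_def)
    have I1: "qpoch 3 (Suc t) * gf (U (l + 2) (1 # u)) = A * y * y * P (l + 3 + t)"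
    proof -
      have "qpoch 3 (Suc t) * gf (U (l + 2) (1 # u)) = fps_X ^ (4 + base u + 6 * t + 3 * Suc t * (l + 2)) * P (l + 2 + Suc t)"
        using IH[of "1 # u" "l + 2"] us u unfolding b by (simp add: t_def)
      also have "fps_X ^ (4 + base u + 6 * t + 3 * Suc t * (l + 2)) = A * y * y"
        unfolding A_def y_def power_add[symmetric] by (rule arg_cong[where f = "(^) fps_X"]) (simp add: algebra_simps)
      finally show ?thesis by (simp add: numeral_3_eq_3)
    qed
    have I2: "fps_X ^ (3 * l + 7) * (qpoch 3 t * gf (U (l + 3) u)) = A * y * P (l + 3 + t)"
    proof -
      have "fps_X ^ (3 * l + 7) * (qpoch 3 t * gf (U (l + 3) u)) =
         fps_X ^ (3 * l + 7) * fps_X ^ (base u + 3 * t * (l + 3)) * P (l + 3 + t)"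
        using IH[of u "l + 3"] us u by (simp add: t_def)
      also have "fps_X ^ (3 * l + 7) * fps_X ^ (base u + 3 * t * (l + 3)) = A * y"
        unfolding A_def y_def power_add[symmetric] by (rule arg_cong[where f = "(^) fps_X"]) (simp add: algebra_simps)
      finally show ?thesis .
    qed
    have I3: "fps_X ^ (3 * l + 4) * (qpoch 3 t * gf (U (l + 2) u)) = A * (1 + z) * P (l + 3 + t)"
    proof -
      have "fps_X ^ (3 * l + 4) * (qpoch 3 t * gf (U (l + 2) u)) =
         fps_X ^ (3 * l + 4) * fps_X ^ (base u + 3 * t * (l + 2)) * P (l + 2 + t)"
        using IH[of u "l + 2"] us u by (simp add: t_def)
      also have "fps_X ^ (3 * l + 4) * fps_X ^ (base u + 3 * t * (l + 2)) = A"
        unfolding A_def power_add[symmetric] by (rule arg_cong[where f = "(^) fps_X"]) (simp add: algebra_simps)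
      also have "P (l + 2 + t) = (1 + z) * P (l + 3 + t)"
        unfolding z_def by (subst P_Suc) (simp_all add: numeral_3_eq_3)
      finally show ?thesis by (simp only: mult.assoc)
    qed
    have I4: "fps_X ^ (3 * l + 4) * (fps_X ^ (3 * l + 6) * (qpoch 3 t * gf (U (l + 3) u))) = A * z * P (l + 3 + t)"
    proof -
      have "fps_X ^ (3 * l + 4) * (fps_X ^ (3 * l + 6) * (qpoch 3 t * gf (U (l + 3) u))) =
         fps_X ^ (3 * l + 4) * fps_X ^ (3 * l + 6) * fps_X ^ (base u + 3 * t * (l + 3)) * P (l + 3 + t)"
        using IH[of u "l + 3"] us u by (simp add: t_def)
      also have "fps_X ^ (3 * l + 4) * fps_X ^ (3 * l + 6) * fps_X ^ (base u + 3 * t * (l + 3)) = A * z"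
        unfolding A_def z_def power_add[symmetric] by (rule arg_cong[where f = "(^) fps_X"]) (simp add: algebra_simps)
      finally show ?thesis .
    qed
    have q: "qpoch 3 (Suc t) = qpoch 3 t * (1 - y)"
      by (simp add: qpoch_Suc y_def algebra_simps)
    have "qpoch 3 (length w) * gf (Z l w) = (1 - fps_X ^ (3 * length w)) * fps_X ^ (3 * l + 2) *
      (qpoch 3 (Suc t) * gf (U (l + 2) (1 # u)) + (1 - y) * (fps_X ^ (3 * l + 7) * (qpoch 3 t * gf (U (l + 3) u))
        + (fps_X ^ (3 * l + 4) * (qpoch 3 t * gf (U (l + 2) u))
           - fps_X ^ (3 * l + 4) * (fps_X ^ (3 * l + 6) * (qpoch 3 t * gf (U (l + 3) u))))))"
    proof -
      have lw: "length w = Suc (Suc t)" by (simp add: u t_def)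
      show ?thesis unfolding lw unfolding qpoch_Suc[of 3 "Suc t"] u gf_Z_2_1 q by (simp add: algebra_simps)
    qed
    \<comment> \<open>All contributions collapse to \<open>A\<close> by
      \<open>y * y + (1 - y) * (y + (1 + z) - z) = 1\<close>; the term \<open>- z\<close> comes from
      the forbidden triples.\<close>
    also have "\<dots> = (1 - fps_X ^ (3 * length w)) * (fps_X ^ (3 * l + 2) * A) * P (l + 3 + t)"
      unfolding I1 I2 I3 I4 by (simp add: algebra_simps)
    also have "fps_X ^ (3 * l + 2) * A = fps_X ^ (base w + 3 * length w * l)"
      unfolding A_def b power_add[symmetric] by (rule arg_cong[where f = "(^) fps_X"]) (simp add: u t_def algebra_simps)
    also have "l + 3 + t = Suc (l + length w)" by (simp add: u t_def)
    finally show ?thesis .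
  qed
qed

lemma fps_mult_nth_eq_0:
  fixes f g :: "int fps"
  assumes "\<And>k. k \<le> n \<Longrightarrow> g $ k = 0"
  shows "(f * g) $ n = 0"
  using assms by (simp add: fps_mult_nth)

lemma gf_U_nth_eq_0:
  assumes "w \<noteq> []" "n < 3 * l"
  shows "gf (U l w) $ n = 0"
proof -
  have "3 * l \<le> sum_list xs" if "xs \<in> U l w" for xs
    using that assms(1) by (cases xs) (auto simp: U_def)
  then have "{xs \<in> U l w. sum_list xs = n} = {}" using assms(2) by force
  then show ?thesis unfolding gf_nth by (simp only: card.empty of_nat_0)
qed

text \<open>For a fixed nonempty word both sides satisfy the same recurrence in \<open>l\<close>,
  with inhomogeneous term known from shorter words, and both tend to 0. Their difference therefore
  vanishes by telescoping.\<close>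

lemma gf_U_closed:
  assumes "set w \<subseteq> {1, 2}" "0 < l"
  shows "qpoch 3 (length w) * gf (U l w) = fps_X ^ (base w + 3 * length w * l) * P (l + length w)"
  using assms
proof (induction w arbitrary: l rule: length_induct)
  case (1 w)
  show ?case
  proof (cases "w = []")
    case False
    define s where "s = length w"
    \<comment> \<open>The index is shifted to \<open>Suc k\<close> because the recurrence for
      \<open>U\<close> requires a positive index.\<close>
    define f where "f k = qpoch 3 s * gf (U (Suc k) w) - fps_X ^ (base w + 3 * s * Suc k) * P (Suc k + s)" for k
    have "f k = 0" for k
    proof (rule fps_eq_0_of_telescoping)
      fix k
      define A y z :: "int fps"
        where "A = fps_X ^ (base w + 3 * s * Suc k)" and "y = fps_X ^ (3 * s)" and "z = fps_X ^ (3 * Suc k)"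
      have "qpoch 3 s * gf (Z (Suc k) w) = (1 - y) * A * P (Suc (Suc k + s))"
        unfolding s_def y_def A_def using 1 by (intro gf_Z_closed) auto
      then have a: "qpoch 3 s * gf (U (Suc k) w) =
          (1 + z) * (qpoch 3 s * gf (U (Suc (Suc k)) w)) + (1 - y) * A * P (Suc (Suc k + s))"
        by (subst gf_U_Suc) (simp_all add: algebra_simps z_def)
      have b: "P (Suc k + s) = (1 + y * z) * P (Suc (Suc k + s))"
        by (subst P_Suc) (simp_all add: y_def z_def power_add[symmetric] algebra_simps)
      have c: "fps_X ^ (base w + 3 * s * Suc (Suc k)) = A * y"
        unfolding A_def y_def power_add[symmetric] by (rule arg_cong[where f = "(^) fps_X"]) (simp add: algebra_simps)
      \<comment> \<open>The terms with \<open>P\<close> match because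
        \<open>A * (1 + y * z) - (1 - y) * A = (1 + z) * A * y\<close>.\<close>
      show "f k = (1 + fps_X ^ (3 * Suc k)) * f (Suc k)"
        unfolding f_def z_def[symmetric] A_def[symmetric] a b c by (simp add: algebra_simps)
    next
      fix k n :: nat
      assume "n < k"
      \<comment> \<open>A nonempty word has \<open>s\<close> at least 1, so the monomial has degree
        at least \<open>k\<close>.\<close>
      moreover have "1 * k \<le> 3 * s * Suc k"
        using False by (intro mult_mono) (auto simp: s_def Suc_le_eq)
      ultimately show "f k $ n = 0"
        unfolding f_def using False
        by (simp add: fps_X_power_mult_nth fps_mult_nth_eq_0 gf_U_nth_eq_0 del: power_Suc)
    qed
    from this[of "l - 1"] show ?thesis
      using 1 by (simp add: f_def s_def)
  qed simp
qed

text \<open>There is no part 0 to take or leave, so the sets \<open>U 1 w\<close> and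
  \<open>Z 0 w\<close> simply add up; their weights \<open>Q^s\<close> and \<open>1 - Q^s\<close>,
  for \<open>s = length w\<close>, sum to 1.\<close>

lemma gf_U_0_closed:
  assumes "set w \<subseteq> {1, 2}"
  shows "qpoch 3 (length w) * gf (U 0 w) = fps_X ^ base w * P (Suc (length w))"
proof -
  have "qpoch 3 (length w) * gf (U 0 w) = qpoch 3 (length w) * gf (U 1 w) + qpoch 3 (length w) * gf (Z 0 w)"
    by (simp add: gf_U_0 algebra_simps)
  also have "qpoch 3 (length w) * gf (U 1 w) = fps_X ^ (base w + 3 * length w * 1) * P (1 + length w)"
    using assms by (intro gf_U_closed) auto
  also have "qpoch 3 (length w) * gf (Z 0 w) =
    (1 - fps_X ^ (3 * length w)) * fps_X ^ (base w + 3 * length w * 0) * P (Suc (0 + length w))"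
    using assms by (intro gf_Z_closed gf_U_closed) auto
  finally show ?thesis by (simp add: power_add algebra_simps)
qed

subsection \<open>Partitions into distinct parts\<close>

text \<open>A plain lower bound \<open>m\<close> on the parts allows integers to be considered one
  at a time, from \<open>m\<close> to \<open>Suc m\<close>.\<close>

definition V :: "nat \<Rightarrow> nat list \<Rightarrow> nat list set" where
  "V m w = {xs. sorted_wrt (<) xs \<and> (\<forall>p\<in>set xs. m \<le> p \<and> p mod 6 \<noteq> 1 \<and> p mod 6 \<noteq> 5) \<and> word xs = w}"

lemma Cons_mem_V_iff:
  "m # xs \<in> V m w \<longleftrightarrow> m mod 6 \<noteq> 1 \<and> m mod 6 \<noteq> 5 \<and> word (m # xs) = w \<and> xs \<in> V (Suc m) (word xs)"
  by (auto simp: V_def Suc_le_eq)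

lemma V_split: "V m w = V (Suc m) w \<union> Cons m ` {xs. m # xs \<in> V m w}"
proof (rule set_eqI)
  fix xs
  show "xs \<in> V m w \<longleftrightarrow> xs \<in> V (Suc m) w \<union> Cons m ` {xs. m # xs \<in> V m w}"
  proof (cases xs)
    case (Cons x ys)
    then show ?thesis
      by (cases "x = m") (auto simp: V_def)
  qed (auto simp: V_def)
qed

lemma gf_V_split:
  assumes "0 < m"
  shows "gf (V m w) = gf (V (Suc m) w) + fps_X ^ m * gf {xs. m # xs \<in> V m w}"
proof -
  have "gf (V m w) = gf (V (Suc m) w \<union> Cons m ` {xs. m # xs \<in> V m w})"
    using V_split by simp
  also have "\<dots> = gf (V (Suc m) w) + gf (Cons m ` {xs. m # xs \<in> V m w})"
    using assms by (intro gf_Un) (auto simp: V_def)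
  finally show ?thesis by (simp add: gf_Cons)
qed

lemma gf_V_skip:
  assumes "0 < m" "m mod 3 \<noteq> 0" "m mod 6 = 1 \<or> m mod 6 = 5 \<or> w = [] \<or> hd w \<noteq> m mod 3"
  shows "gf (V m w) = gf (V (Suc m) w)"
proof -
  have "{xs. m # xs \<in> V m w} = {}"
    using assms by (auto simp: Cons_mem_V_iff word_Cons)
  then show ?thesis using gf_V_split[OF assms(1), of w] by simp
qed

text \<open>A multiple of 3 leaves no letter in the word and is never 1 or 5 modulo 6, so it may be
  freely taken or left.\<close>

lemma gf_V_0:
  assumes "0 < m" "m mod 3 = 0"
  shows "gf (V m w) = (1 + fps_X ^ m) * gf (V (Suc m) w)"
proof -
  have "m mod 6 \<noteq> 1" "m mod 6 \<noteq> 5" using assms(2) by presburger+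
  then have "{xs. m # xs \<in> V m w} = V (Suc m) w"
    using assms by (auto simp: Cons_mem_V_iff word_Cons) (simp_all add: V_def)
  then show ?thesis using gf_V_split[OF assms(1), of w] by (simp add: algebra_simps)
qed

lemma gf_V_Cons:
  assumes "0 < m" "m mod 6 = 2 \<or> m mod 6 = 4" "x = m mod 3"
  shows "gf (V m (x # w)) = gf (V (Suc m) (x # w)) + fps_X ^ m * gf (V (Suc m) w)"
proof -
  have "m mod 3 \<noteq> 0" using assms(2) by presburger
  then have "{xs. m # xs \<in> V m (x # w)} = V (Suc m) w"
    using assms by (auto simp: Cons_mem_V_iff word_Cons) (simp_all add: V_def)
  then show ?thesis using gf_V_split[OF assms(1), of "x # w"] by simp
qed

text \<open>The free choices of the two multiples of 3 among \<open>6 * l + 1\<close>, ...,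
  \<open>6 * l + 6\<close>.\<close>

definition block :: "nat \<Rightarrow> int fps" where
  "block l = (1 + fps_X ^ (6 * l + 3)) * (1 + fps_X ^ (6 * l + 6))"

section \<open>One period of six consecutive integers\<close>

context
  fixes l :: nat
begin

lemma gf_V_1: "gf (V (6 * l + 1) w) = gf (V (6 * l + 2) w)"
proof -
  have m: "(6 * l + 1) mod 3 = 1" "(6 * l + 1) mod 6 = 1" "Suc (6 * l + 1) = 6 * l + 2"
    by presburger+
  show ?thesis using gf_V_skip[of "6 * l + 1" w] unfolding m by simp
qed

lemma gf_V_2_skip:
  assumes "w = [] \<or> hd w \<noteq> 2"
  shows "gf (V (6 * l + 2) w) = gf (V (6 * l + 3) w)"
proof -
  have m: "(6 * l + 2) mod 3 = 2" "Suc (6 * l + 2) = 6 * l + 3"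
    by presburger+
  show ?thesis using assms gf_V_skip[of "6 * l + 2" w] unfolding m by simp
qed

lemma gf_V_2:
  "gf (V (6 * l + 2) (2 # w)) = gf (V (6 * l + 3) (2 # w)) + fps_X ^ (6 * l + 2) * gf (V (6 * l + 3) w)"
proof -
  have m: "(6 * l + 2) mod 3 = 2" "(6 * l + 2) mod 6 = 2" "Suc (6 * l + 2) = 6 * l + 3"
    by presburger+
  show ?thesis using gf_V_Cons[of "6 * l + 2" 2 w] unfolding m by simp
qed

lemma gf_V_3: "gf (V (6 * l + 3) w) = (1 + fps_X ^ (6 * l + 3)) * gf (V (6 * l + 4) w)"
proof -
  have m: "(6 * l + 3) mod 3 = 0" "Suc (6 * l + 3) = 6 * l + 4"
    by presburger+
  show ?thesis using gf_V_0[of "6 * l + 3" w] unfolding m by simp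
qed

lemma gf_V_4_skip:
  assumes "w = [] \<or> hd w \<noteq> 1"
  shows "gf (V (6 * l + 4) w) = gf (V (6 * l + 5) w)"
proof -
  have m: "(6 * l + 4) mod 3 = 1" "Suc (6 * l + 4) = 6 * l + 5"
    by presburger+
  show ?thesis using assms gf_V_skip[of "6 * l + 4" w] unfolding m by simp
qed

lemma gf_V_4:
  "gf (V (6 * l + 4) (1 # w)) = gf (V (6 * l + 5) (1 # w)) + fps_X ^ (6 * l + 4) * gf (V (6 * l + 5) w)"
proof -
  have m: "(6 * l + 4) mod 3 = 1" "(6 * l + 4) mod 6 = 4" "Suc (6 * l + 4) = 6 * l + 5"
    by presburger+
  show ?thesis using gf_V_Cons[of "6 * l + 4" 1 w] unfolding m by simp
qed

lemma gf_V_5: "gf (V (6 * l + 5) w) = (1 + fps_X ^ (6 * l + 6)) * gf (V (6 * Suc l + 1) w)"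
proof -
  have m: "(6 * l + 5) mod 3 = 2" "(6 * l + 5) mod 6 = 5" "(6 * l + 6) mod 3 = 0"
    "Suc (6 * l + 5) = 6 * l + 6" "Suc (6 * l + 6) = 6 * Suc l + 1"
    by presburger+
  show ?thesis
    using gf_V_skip[of "6 * l + 5" w] gf_V_0[of "6 * l + 6" w] unfolding m by simp
qed

lemma gf_V_block_Nil: "gf (V (6 * l + 1) []) = block l * gf (V (6 * Suc l + 1) [])"
  by (simp only: gf_V_1 gf_V_2_skip gf_V_3 gf_V_4_skip gf_V_5 block_def mult.assoc simp_thms)

lemma gf_V_block_1:
  "gf (V (6 * l + 1) (1 # w)) = block l * (gf (V (6 * Suc l + 1) (1 # w)) + fps_X ^ (6 * l + 4) * gf (V (6 * Suc l + 1) w))"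
proof -
  have "gf (V (6 * l + 1) (1 # w)) = gf (V (6 * l + 3) (1 # w))"
    using gf_V_1[of "1 # w"] gf_V_2_skip[of "1 # w"] by simp
  then show ?thesis
    unfolding gf_V_3 gf_V_4 gf_V_5 block_def by (simp only: algebra_simps)
qed

lemma gf_V_block_2:
  assumes "w = [] \<or> hd w \<noteq> 1"
  shows "gf (V (6 * l + 1) (2 # w)) = block l * (gf (V (6 * Suc l + 1) (2 # w)) + fps_X ^ (6 * l + 2) * gf (V (6 * Suc l + 1) w))"
proof -
  have "gf (V (6 * l + 4) (2 # w)) = gf (V (6 * l + 5) (2 # w))" by (rule gf_V_4_skip) simp
  then show ?thesis
    unfolding gf_V_1 gf_V_2 gf_V_3 gf_V_4_skip[OF assms] gf_V_5 block_def by (simp only: algebra_simps gf_V_5)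
qed

text \<open>Only the pattern 2, 1 fits two letters into one period, as \<open>6 * l + 2\<close> and
  \<open>6 * l + 4\<close>; this mirrors the exceptional case of \<open>Z_2_1\<close>.\<close>

lemma gf_V_block_2_1:
  "gf (V (6 * l + 1) (2 # 1 # w)) = block l * (gf (V (6 * Suc l + 1) (2 # 1 # w)) + fps_X ^ (6 * l + 2) *
     (gf (V (6 * Suc l + 1) (1 # w)) + fps_X ^ (6 * l + 4) * gf (V (6 * Suc l + 1) w)))"
proof -
  have "gf (V (6 * l + 4) (2 # 1 # w)) = gf (V (6 * l + 5) (2 # 1 # w))" by (rule gf_V_4_skip) simp
  then show ?thesis
    unfolding gf_V_1 gf_V_2 gf_V_3 gf_V_4 gf_V_5 block_def by (simp only: algebra_simps gf_V_5)
qed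

end

lemma gf_V_nth_eq_0:
  assumes "w \<noteq> []" "n < m"
  shows "gf (V m w) $ n = 0"
proof -
  have "m \<le> sum_list xs" if "xs \<in> V m w" for xs
    using that assms(1) by (cases xs) (auto simp: V_def)
  then have "{xs \<in> V m w. sum_list xs = n} = {}" using assms(2) by force
  then show ?thesis unfolding gf_nth by (simp only: card.empty of_nat_0)
qed

text \<open>Again by uniqueness of the solution, now with periods of 6 in place of 3. The index
  \<open>l = 0\<close> is included, as the bound \<open>6 * l + 1\<close> is always
  positive.\<close>

lemma gf_V_closed:
  assumes "set w \<subseteq> {1, 2}"
  shows "qpoch 6 (length w) * gf (V (6 * l + 1) w) = fps_X ^ (base w + 6 * length w * l) * gf (V (6 * l + 1) [])"
  using assms
proof (induction w arbitrary: l rule: length_induct)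
  case (1 w)
  define R where "R l = gf (V (6 * l + 1) [])" for l
  have IH: "qpoch 6 (length v) * gf (V (6 * l + 1) v) = fps_X ^ (base v + 6 * length v * l) * R l"
    if "length v < length w" "set v \<subseteq> {1, 2}" for v l
    using 1(1) that unfolding R_def by blast
  show ?case
  proof (cases w)
    case (Cons x v)
    define s t where "s = length w" and "t = length v"
    have st: "s = Suc t" by (simp add: s_def t_def Cons)
    have v: "set v \<subseteq> {1, 2}" and lv: "length v < length w" using 1 Cons by auto
    have x: "x = 1 \<or> x = 2" using 1 Cons by auto
    \<comment> \<open>Up to the factor \<open>block l\<close>, the series \<open>Y\<close> counts
      the lists that take at least one letter within the period.\<close>
    have "\<exists>Y. gf (V (6 * l + 1) w) = block l * (gf (V (6 * Suc l + 1) w) + Y) \<and>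
        qpoch 6 s * Y = (1 - fps_X ^ (6 * s)) * fps_X ^ (base w + 6 * s * l) * R (Suc l)" for l
    proof (cases "x = 2 \<and> v \<noteq> [] \<and> hd v = 1")
      case False
      define c :: nat where "c = (if x = 1 then 4 else 2)"
      have b: "base w = c + base v + 6 * t"
        using False Cons by (auto simp: c_def t_def)
      define Y where "Y = fps_X ^ (6 * l + c) * gf (V (6 * Suc l + 1) v)"
      have "gf (V (6 * l + 1) w) = block l * (gf (V (6 * Suc l + 1) w) + Y)"
        using x False Cons gf_V_block_1[of l v] gf_V_block_2[of v l] by (auto simp: c_def Y_def)
      moreover have "qpoch 6 s * Y = (1 - fps_X ^ (6 * s)) * fps_X ^ (base w + 6 * s * l) * R (Suc l)"
      proof -
        have "qpoch 6 s * Y =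
            (1 - fps_X ^ (6 * s)) * (fps_X ^ (6 * l + c) * (qpoch 6 t * gf (V (6 * Suc l + 1) v)))"
          unfolding Y_def st qpoch_Suc by (simp only: mult_ac)
        also have "\<dots> = (1 - fps_X ^ (6 * s)) * (fps_X ^ (6 * l + c) * fps_X ^ (base v + 6 * t * Suc l)) * R (Suc l)"
          unfolding t_def IH[OF lv v] by (simp only: mult_ac)
        also have "fps_X ^ (6 * l + c) * fps_X ^ (base v + 6 * t * Suc l) = (fps_X ^ (base w + 6 * s * l) :: int fps)"
          unfolding b st power_add[symmetric] by (rule arg_cong[where f = "(^) fps_X"]) (simp add: algebra_simps)
        finally show ?thesis .
      qed
      ultimately show ?thesis by blast
    next
      case True
      then obtain u where u: "w = 2 # 1 # u" using Cons by (cases v) auto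
      define r where "r = length u"
      have sr: "s = Suc (Suc r)" by (simp add: s_def r_def u)
      have us: "set u \<subseteq> {1, 2}" "set (1 # u) \<subseteq> {1, 2::nat}" using v u Cons by auto
      have lu: "length u < length w" "length (1 # u) < length w" using u by simp_all
      have b: "base w = 6 + base u + 6 * r" "base (1 # u) = 4 + base u + 6 * r"
        using u by (simp_all add: r_def)
      define A y :: "int fps"
        where "A = fps_X ^ (6 * l + 4 + base u + 6 * r * l + 6 * r)" and "y = fps_X ^ (6 * Suc r)"
      define Y where "Y = fps_X ^ (6 * l + 2) *
        (gf (V (6 * Suc l + 1) (1 # u)) + fps_X ^ (6 * l + 4) * gf (V (6 * Suc l + 1) u))"
      have I1: "qpoch 6 (Suc r) * gf (V (6 * Suc l + 1) (1 # u)) = A * y * R (Suc l)"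
      proof -
        have "qpoch 6 (Suc r) * gf (V (6 * Suc l + 1) (1 # u)) = fps_X ^ (base (1 # u) + 6 * Suc r * Suc l) * R (Suc l)"
          using IH[OF lu(2) us(2), of "Suc l"] by (simp add: r_def)
        also have "fps_X ^ (base (1 # u) + 6 * Suc r * Suc l) = A * y"
          unfolding b A_def y_def power_add[symmetric] by (rule arg_cong[where f = "(^) fps_X"]) (simp add: algebra_simps)
        finally show ?thesis .
      qed
      have I2: "fps_X ^ (6 * l + 4) * (qpoch 6 r * gf (V (6 * Suc l + 1) u)) = A * R (Suc l)"
      proof -
        have "fps_X ^ (6 * l + 4) * (qpoch 6 r * gf (V (6 * Suc l + 1) u)) =
            fps_X ^ (6 * l + 4) * fps_X ^ (base u + 6 * r * Suc l) * R (Suc l)"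
          unfolding r_def IH[OF lu(1) us(1)] by (simp only: mult_ac)
        also have "fps_X ^ (6 * l + 4) * fps_X ^ (base u + 6 * r * Suc l) = A"
          unfolding A_def power_add[symmetric] by (rule arg_cong[where f = "(^) fps_X"]) (simp add: algebra_simps)
        finally show ?thesis .
      qed
      have q: "qpoch 6 (Suc r) = qpoch 6 r * (1 - y)"
        by (simp only: qpoch_Suc y_def)
      have "qpoch 6 s * Y = (1 - fps_X ^ (6 * s)) * (fps_X ^ (6 * l + 2) *
          (qpoch 6 (Suc r) * gf (V (6 * Suc l + 1) (1 # u)) +
           (1 - y) * (fps_X ^ (6 * l + 4) * (qpoch 6 r * gf (V (6 * Suc l + 1) u)))))"
        unfolding Y_def sr unfolding qpoch_Suc[of 6 "Suc r"] q by (simp only: algebra_simps)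
      \<comment> \<open>One letter taken gives \<open>A * y\<close>, two letters give
        \<open>(1 - y) * A\<close>; together they make \<open>A\<close>.\<close>
      also have "\<dots> = (1 - fps_X ^ (6 * s)) * (fps_X ^ (6 * l + 2) * A) * R (Suc l)"
        unfolding I1 I2 by (simp add: algebra_simps)
      also have "fps_X ^ (6 * l + 2) * A = fps_X ^ (base w + 6 * s * l)"
        unfolding A_def b sr power_add[symmetric] by (rule arg_cong[where f = "(^) fps_X"]) (simp add: algebra_simps)
      finally show ?thesis
        using gf_V_block_2_1[of l u] unfolding u Y_def by blast
    qed
    then obtain Y where Y: "\<And>l. gf (V (6 * l + 1) w) = block l * (gf (V (6 * Suc l + 1) w) + Y l)"
        "\<And>l. qpoch 6 s * Y l = (1 - fps_X ^ (6 * s)) * fps_X ^ (base w + 6 * s * l) * R (Suc l)"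
      by metis
    define f where "f k = qpoch 6 s * gf (V (6 * k + 1) w) - fps_X ^ (base w + 6 * s * k) * R k" for k
    have "f k = 0" for k
    proof (rule fps_eq_0_of_telescoping)
      fix k
      define A y :: "int fps"
        where "A = fps_X ^ (base w + 6 * s * k)" and "y = fps_X ^ (6 * s)"
      have a: "qpoch 6 s * gf (V (6 * k + 1) w) =
          block k * (qpoch 6 s * gf (V (6 * Suc k + 1) w) + (1 - y) * A * R (Suc k))"
        unfolding Y(1)[of k] y_def A_def Y(2)[of k, symmetric] by (simp only: algebra_simps)
      have b: "R k = block k * R (Suc k)"
        unfolding R_def by (rule gf_V_block_Nil)
      have c: "fps_X ^ (base w + 6 * s * Suc k) = A * y"
        unfolding A_def y_def power_add[symmetric] by (rule arg_cong[where f = "(^) fps_X"]) (simp add: algebra_simps)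
      show "f k = block k * f (Suc k)"
        unfolding f_def A_def[symmetric] a b c by (simp add: algebra_simps)
    next
      fix k n :: nat
      assume "n < k"
      moreover have "1 * k \<le> 6 * s * k"
        by (intro mult_mono) (auto simp: st)
      ultimately have "n < base w + 6 * s * k" "n < 6 * k + 1" "w \<noteq> []"
        using Cons by (linarith, linarith, simp)
      then show "f k $ n = 0"
        unfolding f_def
        by (simp add: fps_X_power_mult_nth fps_mult_nth_eq_0 gf_V_nth_eq_0)
    qed
    from this[of l] show ?thesis
      by (simp add: f_def s_def R_def)
  qed simp
qed

section \<open>Matching the two closed forms\<close>

lemma word_eq_Nil_iff: "word xs = [] \<longleftrightarrow> (\<forall>p\<in>set xs. 3 dvd p)"
  by (auto simp: word_def filter_empty_conv mod_eq_0_iff_dvd)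

text \<open>Distinct multiples of 3 differ by at least 3, so no difference of 2 arises, and the gap
  of 5 is never demanded.\<close>

lemma good_multiples_of_3:
  "\<forall>p\<in>set xs. 3 dvd p \<Longrightarrow> good xs \<longleftrightarrow> sorted_wrt (<) xs"
proof (induction xs rule: good.induct)
  case (1 x y zs)
  then have d: "3 dvd x" "3 dvd y" and IH: "good (y # zs) \<longleftrightarrow> sorted_wrt (<) (y # zs)" by auto
  have "step x y \<longleftrightarrow> x < y" using d unfolding step_def by presburger
  moreover have "y \<noteq> x + 2" using d by presburger
  moreover have "sorted_wrt (<) (x # y # zs) \<longleftrightarrow> x < y \<and> sorted_wrt (<) (y # zs)"
    by (auto dest: less_trans)
  ultimately show ?case using IH by simp
qed auto

lemma V_Nil_eq_U_Nil: "V 1 [] = U 1 []"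
proof (rule set_eqI)
  fix xs
  show "xs \<in> V 1 [] \<longleftrightarrow> xs \<in> U 1 []"
  proof (cases "\<forall>p\<in>set xs. 3 dvd p")
    case True
    have "(1 \<le> p \<and> p mod 6 \<noteq> 1 \<and> p mod 6 \<noteq> 5) \<longleftrightarrow> 1 < p"
      "1 < p \<longleftrightarrow> 3 * 1 \<le> p \<and> p \<noteq> 3 * 1 + 1" if "3 dvd p" for p :: nat
      using that by presburger+
    then show ?thesis using True good_multiples_of_3[OF True] word_eq_Nil_iff[of xs]
      unfolding V_def U_def by (cases xs) auto
  qed (use word_eq_Nil_iff[of xs] in \<open>auto simp: V_def U_def\<close>)
qed

text \<open>Since \<open>1 - Q^(2m) = (1 - Q^m) * (1 + Q^m)\<close>, each factor of
  \<open>qpoch 6\<close> supplies the factor \<open>1 + Q^m\<close> that turns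
  \<open>P (Suc m)\<close> into \<open>P m\<close>.\<close>

lemma qpoch_double: "qpoch 6 s * P (Suc s) = qpoch 3 s * P 1"
proof (induction s)
  case (Suc s)
  have "qpoch 6 (Suc s) * P (Suc (Suc s)) = qpoch 6 s * ((1 - fps_X ^ (3 * Suc s)) * ((1 + fps_X ^ (3 * Suc s)) * P (Suc (Suc s))))"
  proof -
    have "6 * Suc s = 3 * Suc s + 3 * Suc s" by simp
    then have "(fps_X ^ (6 * Suc s) :: int fps) = fps_X ^ (3 * Suc s) * fps_X ^ (3 * Suc s)"
      by (metis power_add)
    then show ?thesis unfolding qpoch_Suc by (simp only: algebra_simps mult_1)
  qed
  also have "\<dots> = (1 - fps_X ^ (3 * Suc s)) * (qpoch 6 s * P (Suc s))"
    unfolding P_Suc[of "Suc s", symmetric, OF zero_less_Suc] by (simp only: mult_ac)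
  also have "\<dots> = qpoch 3 (Suc s) * P 1"
    unfolding Suc qpoch_Suc by (simp only: mult_ac)
  finally show ?case .
qed simp

lemma gf_U_eq_gf_V:
  assumes "set w \<subseteq> {1, 2}"
  shows "gf (U 0 w) = gf (V 1 w)"
proof -
  define s where "s = length w"
  have V: "qpoch 6 s * gf (V 1 w) = fps_X ^ base w * P 1"
    using gf_V_closed[OF assms, of 0] V_Nil_eq_U_Nil by (simp add: s_def)
  have "(qpoch 3 s * qpoch 6 s) * gf (U 0 w) = qpoch 6 s * (qpoch 3 s * gf (U 0 w))"
    by (simp only: mult_ac)
  also have "\<dots> = fps_X ^ base w * (qpoch 6 s * P (Suc s))"
    unfolding s_def gf_U_0_closed[OF assms] by (simp only: mult_ac)
  also have "\<dots> = qpoch 3 s * (qpoch 6 s * gf (V 1 w))"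
    unfolding qpoch_double V by (simp only: mult_ac)
  also have "\<dots> = (qpoch 3 s * qpoch 6 s) * gf (V 1 w)"
    by (simp only: mult_ac)
  \<comment> \<open>Both denominators are nonzero in an integral domain and cancel.\<close>
  finally show ?thesis by (simp add: qpoch_neq_0)
qed

subsection \<open>Comparison\<close>

lemma good_snoc:
  "good (xs @ [y, x]) \<longleftrightarrow> good (xs @ [y]) \<and> step y x \<and> \<not> (xs \<noteq> [] \<and> y = last xs + 2 \<and> x = y + 2)"
  by (induction xs rule: good.induct) (auto simp: hd_append)

text \<open>Position 0 is split off the quantifier. A truncated difference of at least 2 already
  forces the right order, so it agrees with \<open>step\<close>.\<close>

lemma gap_condition_Cons:
  "gap_condition (x # y # ps) \<longleftrightarrow> step y x \<and> gap_condition (y # ps)"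
proof -
  have "(\<forall>k. Q k) \<longleftrightarrow> Q 0 \<and> (\<forall>k. Q (Suc k))" for Q :: "nat \<Rightarrow> bool"
    by (metis nat.exhaust)
  note this[of "\<lambda>k. Suc k < length (x # y # ps) \<longrightarrow> _ k"]
  then show ?thesis
    unfolding gap_condition_def step_def by auto
qed

lemma no_three_successive_by_2_Cons:
  "no_three_successive_by_2 (x # y # ps) \<longleftrightarrow>
    \<not> (ps \<noteq> [] \<and> y = hd ps + 2 \<and> x = y + 2) \<and> no_three_successive_by_2 (y # ps)"
proof -
  have "(\<exists>k. Q k) \<longleftrightarrow> Q 0 \<or> (\<exists>k. Q (Suc k))" for Q :: "nat \<Rightarrow> bool"
    by (metis nat.exhaust)
  note this[of "\<lambda>k. k + 2 < length (x # y # ps) \<and> _ k"]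
  then show ?thesis
    unfolding no_three_successive_by_2_def by (cases ps) auto
qed

lemma good_rev: "good (rev ps) \<longleftrightarrow> gap_condition ps \<and> no_three_successive_by_2 ps"
proof (induction ps rule: good.induct)
  case (1 x y ps)
  then show ?case
    by (simp add: good_snoc gap_condition_Cons no_three_successive_by_2_Cons last_rev) auto
qed (simp_all add: gap_condition_def no_three_successive_by_2_def)

lemma good_imp_sorted: "good xs \<Longrightarrow> sorted_wrt (<) xs"
proof (induction xs)
  case (Cons x xs)
  then show ?case using good_ge[of x xs] by (auto simp: good_Cons_eq)
qed simp

lemma parts_congruent_rev: "parts_congruent r m (rev ps) = parts_congruent r m ps"
  by (simp add: parts_congruent_def rev_filter[symmetric])

lemma parts_congruent_word:
  "parts_congruent 1 3 ps = count_list (word ps) 1" "parts_congruent 2 3 ps = count_list (word ps) 2"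
  by (induction ps) (auto simp: parts_congruent_def word_Cons)

lemma set_word: "set (word xs) \<subseteq> {1, 2}"
  by (auto simp: word_def)

lemma rev_image_eqI:
  assumes "\<And>ps. ps \<in> A \<longleftrightarrow> Q (rev ps)"
  shows "rev ` A = {xs. Q xs}"
proof (intro equalityI subsetI)
  fix xs
  assume "xs \<in> {xs. Q xs}"
  then have "rev xs \<in> A" using assms by simp
  then show "xs \<in> rev ` A" by (metis imageI rev_rev_ident)
qed (use assms in auto)

lemma rev_C_star_partitions:
  "rev ` C_star_partitions n i j = {xs. xs \<in> U 0 (word xs) \<and> sum_list xs = n \<and>
     count_list (word xs) 1 = i \<and> count_list (word xs) 2 = j}"
proof -
  have "ps \<in> C_star_partitions n i j \<longleftrightarrow> rev ps \<in> U 0 (word (rev ps)) \<and> sum_list (rev ps) = n \<and>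
     count_list (word (rev ps)) 1 = i \<and> count_list (word (rev ps)) 2 = j" for ps
  proof -
    have "sorted_wrt (\<ge>) ps" if "good (rev ps)"
    proof -
      have "sorted_wrt (\<lambda>x y. y < x) ps"
        using good_imp_sorted[OF that] by (simp add: sorted_wrt_rev)
      then show ?thesis by (rule sorted_wrt_mono_rel[rotated]) simp
    qed
    \<comment> \<open>This is the head condition of \<open>U\<close> at \<open>l = 0\<close>, where
      \<open>3 * l + 1\<close> is 1.\<close>
    moreover have "rev ps \<noteq> [] \<longrightarrow> hd (rev ps) \<noteq> 1" if "\<forall>p\<in>set ps. 1 < p"
      using that by (metis hd_in_set less_irrefl set_rev)
    ultimately show ?thesis
      unfolding C_star_partitions_def is_partition_def U_def parts_congruent_word[symmetric] parts_congruent_rev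
      using good_rev[of ps] by (auto simp del: One_nat_def)
  qed
  then show ?thesis by (rule rev_image_eqI)
qed

lemma rev_D_partitions:
  "rev ` D_partitions n i j = {xs. xs \<in> V 1 (word xs) \<and> sum_list xs = n \<and>
     count_list (word xs) 1 = i \<and> count_list (word xs) 2 = j}"
proof -
  have "ps \<in> D_partitions n i j \<longleftrightarrow> rev ps \<in> V 1 (word (rev ps)) \<and> sum_list (rev ps) = n \<and>
     count_list (word (rev ps)) 1 = i \<and> count_list (word (rev ps)) 2 = j" for ps
  proof -
    have "sorted_wrt (\<ge>) ps \<and> distinct ps \<longleftrightarrow> sorted_wrt (<) (rev ps)"
      using strict_sorted_iff[of "rev ps"] by (simp add: sorted_wrt_rev)
    then show ?thesis
      unfolding D_partitions_def is_partition_def V_def parts_congruent_word[symmetric] parts_congruent_rev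
      by (auto simp: Suc_le_eq)
  qed
  then show ?thesis by (rule rev_image_eqI)
qed

theorem theorem2p1:
  fixes n i j :: nat
  shows "C_star n i j = D n i j"
proof -
  define A where "A = rev ` C_star_partitions n i j"
  define B where "B = rev ` D_partitions n i j"
  have fin: "finite A" "finite B"
    unfolding A_def B_def by (simp_all add: finite_C_star_partitions finite_D_partitions)
  \<comment> \<open>The counts agree on every fibre of \<open>word\<close>. Words with the wrong
    letter counts have empty fibres on both sides.\<close>
  have eq: "card {xs \<in> A. word xs = w} = card {xs \<in> B. word xs = w}" for w
  proof (cases "set w \<subseteq> {1, 2} \<and> count_list w 1 = i \<and> count_list w 2 = j")
    case True
    then have "{xs \<in> A. word xs = w} = {xs \<in> U 0 w. sum_list xs = n}"
      "{xs \<in> B. word xs = w} = {xs \<in> V 1 w. sum_list xs = n}"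
      unfolding A_def B_def rev_C_star_partitions rev_D_partitions by (auto simp: U_def V_def)
    moreover have "gf (U 0 w) $ n = gf (V 1 w) $ n"
      using True gf_U_eq_gf_V by simp
    ultimately show ?thesis by (simp add: gf_nth)
  next
    case False
    then have "{xs \<in> A. word xs = w} = {}" "{xs \<in> B. word xs = w} = {}"
      unfolding A_def B_def rev_C_star_partitions rev_D_partitions using set_word by blast+
    then show ?thesis by (simp only:)
  qed
  \<comment> \<open>One finite index set covers the words of both \<open>A\<close> and
    \<open>B\<close>, so the two sums can be compared term by term.\<close>
  have fibres: "card S = (\<Sum>w\<in>word ` A \<union> word ` B. card {xs \<in> S. word xs = w})" if "S = A \<or> S = B" for S
    using that fin by (subst sum.group[of S "word ` A \<union> word ` B" word "\<lambda>_. 1 :: nat", simplified, symmetric]) auto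
  have "card A = card B"
    using fibres[of A] fibres[of B] eq by simp
  then show ?thesis
    unfolding A_def B_def C_star_def D_def by (simp add: card_image)
qed

end
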